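(* Let $\Omega$ be the set of all prompts to an ideal AI system and let $T_\Omega$ denote the truths in it. For any checker $C_\Omega(T_\Omega,p)$ there exists a truth $T_\Omega$ such that $C_\Omega(T_\Omega,p)\neq 1$ for all $p$.
   Context: The AI system is ideal: it takes prompts of unlimited length and has no constraints on available compute. Prompts are strings of arbitrary length and of arbitrary (or no) meaning; $\Omega$ is the set of all prompts, contains all possible strings, and $\operatorname{card}(\Omega)=\aleph_0$. $T_\Omega$ denotes a truth in $\Omega$; the space of possible truths is regarded as approximately as large as that for humanity. Truth and its verification are treated as strings and algorithms. A checker $C(T,p)$ returns $1$ if and only if $T$ is true and there is a verifiable proof $p$ of it that is accessible to $C$ and that the checker can verify; proofs take the form of checkers or halting programs running on a general computing platform. $C_\Omega$ is such a checker for truths in $\Omega$. A statement used as $T_\Omega$, for $x\in\Omega$ and a positive integer $n$, is "every algorithm that outputs $x$ is of length $>n$" (lengths in bits). *)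

theory Defs
  imports "HOL-Library.Countable_Set"
begin

section \<open>Prompts\<close>

definition Omega :: "string set" where
  "Omega = UNIV"

lemma card_Omega: "infinite Omega" "countable Omega"
  by (simp_all add: Omega_def infinite_UNIV_listI)


section \<open>Algorithms\<close>

text \<open>
  The general computing platform is a WHILE language over an unbounded supply of registers, each
  holding an arbitrary string that is accessed like a stack from its left end. Programs with
  two registers used as the two halves of a tape simulate any Turing machine, so every
  partial computable function on strings is computed by a program. \<open>IfHead r a P Q\<close>
  runs \<open>P\<close> if register \<open>r\<close> is nonempty with first character \<open>a\<close>, and
  \<open>Q\<close> otherwise; \<open>While r P\<close> repeats \<open>P\<close> as long as register \<open>r\<close> is nonempty.
\<close>

datatype program =
    Skip
  | Push nat char
  | Pop nat
  | Seq program program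
  | IfHead nat char program program
  | While nat program

type_synonym state = "nat \<Rightarrow> string"

inductive exec :: "program \<Rightarrow> state \<Rightarrow> state \<Rightarrow> bool" where
  Skip: "exec Skip s s"
| Push: "exec (Push r a) s (s(r := a # s r))"
| Pop: "exec (Pop r) s (s(r := tl (s r)))"
| Seq: "exec P s t \<Longrightarrow> exec Q t u \<Longrightarrow> exec (Seq P Q) s u"
| IfTrue: "s r = a # w \<Longrightarrow> exec P s t \<Longrightarrow> exec (IfHead r a P Q) s t"
| IfFalse: "(\<nexists>w. s r = a # w) \<Longrightarrow> exec Q s t \<Longrightarrow> exec (IfHead r a P Q) s t"
| WhileDone: "s r = [] \<Longrightarrow> exec (While r P) s s"
| WhileStep: "s r \<noteq> [] \<Longrightarrow> exec P s t \<Longrightarrow> exec (While r P) t u \<Longrightarrow> exec (While r P) s u"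

lemma exec_deterministic: "exec P s t \<Longrightarrow> exec P s u \<Longrightarrow> t = u"
proof (induction arbitrary: u rule: exec.induct)
  case (Skip s)
  then show ?case by cases auto
next
  case (Push r a s)
  then show ?case by cases auto
next
  case (Pop r s)
  then show ?case by cases auto
next
  case (Seq P s t Q v)
  from Seq.prems show ?case by cases (use Seq.IH in blast)
next
  case (IfTrue s r a w P t Q)
  from IfTrue.prems show ?case by cases (use IfTrue.hyps IfTrue.IH in blast)+
next
  case (IfFalse s r a Q t P)
  from IfFalse.prems show ?case by cases (use IfFalse.hyps IfFalse.IH in blast)+
next
  case (WhileDone s r P)
  from WhileDone.prems show ?case by cases (use WhileDone.hyps in blast)+
next
  case (WhileStep s r P t v)
  from WhileStep.prems show ?case by cases (use WhileStep.hyps WhileStep.IH in blast)+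
qed

text \<open>
  Inputs are placed in the first registers, all others start empty, and the result is read off
  register 0. There is no result if the program does not halt.
\<close>

definition computes :: "program \<Rightarrow> string list \<Rightarrow> string \<Rightarrow> bool" where
  "computes P xs y \<longleftrightarrow>
     (\<exists>t. exec P (\<lambda>i. if i < length xs then xs ! i else []) t \<and> t 0 = y)"

definition outputs :: "program \<Rightarrow> string \<Rightarrow> bool" where
  "outputs P x \<longleftrightarrow> computes P [] x"

lemma computes_unique: "computes P xs y \<Longrightarrow> computes P xs z \<Longrightarrow> y = z"
  unfolding computes_def using exec_deterministic by blast


subsection \<open>Length in bits\<close>

text \<open>
  Programs are written as bit strings in a prefix-free code: a three-bit operation code, register
  numbers in unary, and characters as eight bits.
\<close>

definition unary_bits :: "nat \<Rightarrow> bool list" where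
  "unary_bits r = replicate r True @ [False]"

fun char_bits :: "char \<Rightarrow> bool list" where
  "char_bits (Char b0 b1 b2 b3 b4 b5 b6 b7) = [b0, b1, b2, b3, b4, b5, b6, b7]"

fun program_bits :: "program \<Rightarrow> bool list" where
  "program_bits Skip = [False, False, False]"
| "program_bits (Push r a) = [False, False, True] @ unary_bits r @ char_bits a"
| "program_bits (Pop r) = [False, True, False] @ unary_bits r"
| "program_bits (Seq P Q) = [False, True, True] @ program_bits P @ program_bits Q"
| "program_bits (IfHead r a P Q) =
     [True, False, False] @ unary_bits r @ char_bits a @ program_bits P @ program_bits Q"
| "program_bits (While r P) = [True, False, True] @ unary_bits r @ program_bits P"

definition bit_length :: "program \<Rightarrow> nat" where
  "bit_length P = length (program_bits P)"

lemma unary_bits_prefix_free: "unary_bits r @ u = unary_bits r' @ v \<longleftrightarrow> r = r' \<and> u = v"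
proof (induction r arbitrary: r')
  case 0
  show ?case by (cases r') (auto simp: unary_bits_def)
next
  case (Suc r)
  show ?case using Suc by (cases r') (auto simp: unary_bits_def)
qed

lemma char_bits_prefix_free: "char_bits a @ u = char_bits b @ v \<longleftrightarrow> a = b \<and> u = v"
  by (cases a; cases b) auto

lemma program_bits_prefix_free:
  "program_bits P @ u = program_bits Q @ v \<longleftrightarrow> P = Q \<and> u = v"
proof (induction P arbitrary: Q u v)
  case Skip
  show ?case by (cases Q) auto
next
  case (Push r a)
  show ?case by (cases Q) (auto simp: unary_bits_prefix_free char_bits_prefix_free)
next
  case (Pop r)
  show ?case by (cases Q) (auto simp: unary_bits_prefix_free)
next
  case (Seq P1 P2)
  show ?case by (cases Q) (simp_all add: Seq.IH)
next
  case (IfHead r a P1 P2)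
  show ?case
    by (cases Q) (simp_all add: unary_bits_prefix_free char_bits_prefix_free IfHead.IH)
next
  case (While r P)
  show ?case by (cases Q) (simp_all add: unary_bits_prefix_free While.IH)
qed

lemma inj_program_bits: "inj program_bits"
  by (rule injI) (use program_bits_prefix_free[of _ "[]" _ "[]"] in simp)


section \<open>Truths\<close>

fun decimal :: "nat \<Rightarrow> string" where
  "decimal n = (if n < 10 then [char_of (48 + n)]
     else decimal (n div 10) @ [char_of (48 + n mod 10)])"

declare decimal.simps [simp del]

definition length_statement :: "string \<Rightarrow> nat \<Rightarrow> string" where
  "length_statement x n =
     ''every algorithm that outputs '' @ x @ '' is of length >'' @ decimal n"

text \<open>
  The set of true prompts is left open, since prompts may have any meaning or none; it is only
  required that the statements on program length are understood as they read.
\<close>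

definition truths_in_Omega :: "string set \<Rightarrow> bool" where
  "truths_in_Omega Tr \<longleftrightarrow> Tr \<subseteq> Omega \<and>
     (\<forall>x\<in>Omega. \<forall>n>0. length_statement x n \<in> Tr \<longleftrightarrow>
        (\<forall>P. outputs P x \<longrightarrow> bit_length P > n))"

lemma decimal_value: "foldl (\<lambda>k a. 10 * k + (of_char a - 48)) 0 (decimal n) = n"
proof (induction n rule: decimal.induct)
  case (1 n)
  show ?case
  proof (cases "n < 10")
    case True
    then show ?thesis by (subst decimal.simps) simp
  next
    case False
    then show ?thesis using 1 by (subst decimal.simps) simp
  qed
qed

lemma inj_decimal: "decimal m = decimal n \<Longrightarrow> m = n"
  by (metis decimal_value)

lemma decimal_no_greater: "CHR ''>'' \<notin> set (decimal n)"
proof (induction n rule: decimal.induct)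
  case (1 n)
  have *: "CHR ''>'' \<noteq> char_of (48 + k)" if "k < 10" for k :: nat
  proof
    assume "CHR ''>'' = char_of (48 + k)"
    then have "(of_char (CHR ''>'') :: nat) = of_char (char_of (48 + k) :: char)" by simp
    with that show False by simp
  qed
  show ?case using 1 * by (subst decimal.simps) auto
qed

lemma length_statement_inject:
  assumes "length_statement x m = length_statement y n"
  shows "x = y \<and> m = n"
proof -
  have eq: "(x @ '' is of length '') @ CHR ''>'' # decimal m
      = (y @ '' is of length '') @ CHR ''>'' # decimal n"
    using assms by (simp add: length_statement_def)
  have "takeWhile (\<lambda>a. a \<noteq> CHR ''>'') (rev (u @ CHR ''>'' # decimal k)) = rev (decimal k)" for u k
    using decimal_no_greater[of k] by (simp add: takeWhile_append)
  from this[of "x @ '' is of length ''" m] this[of "y @ '' is of length ''" n]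
  have "decimal m = decimal n"
    unfolding eq by simp
  with eq show ?thesis using inj_decimal by simp
qed

lemma ex_truths_in_Omega: "\<exists>Tr. truths_in_Omega Tr"
proof -
  let ?Tr = "{length_statement x n | x n. \<forall>P. outputs P x \<longrightarrow> bit_length P > n}"
  have "length_statement x n \<in> ?Tr \<longleftrightarrow> (\<forall>P. outputs P x \<longrightarrow> bit_length P > n)" for x n
    using length_statement_inject by blast
  then have "truths_in_Omega ?Tr"
    unfolding truths_in_Omega_def Omega_def by blast
  then show ?thesis by blast
qed


section \<open>Checkers\<close>

text \<open>
  \<open>verifiable T p\<close> stands for: \<open>p\<close> is a proof of \<open>T\<close> that is accessible to the checker and
  that it can verify. A checker need not halt on other inputs.
\<close>

definition is_checker :: "string set \<Rightarrow> (string \<Rightarrow> string \<Rightarrow> bool) \<Rightarrow> program \<Rightarrow> bool" where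
  "is_checker Tr verifiable C \<longleftrightarrow>
     (\<forall>T\<in>Omega. \<forall>p. computes C [T, p] ''1'' \<longleftrightarrow> T \<in> Tr \<and> verifiable T p)"

end

theory Submission
  imports Defs
begin

text \<open>
  This is Chaitin's argument. If every truth had an accepted proof, the true statements about
  program length would be exactly those with an accepted proof. One could then search all triples
  of a candidate, a string and a time bound for an accepted proof of ``every algorithm that outputs
  the candidate is of length \<open>> 10 ^ k\<close>'', and output that candidate. The search succeeds, as there
  are only finitely many programs of length \<open>\<le> 10 ^ k\<close>, but the search program itself has length
  linear in \<open>k\<close>.

  No universal program is needed: the checker is rewritten into one that consumes fuel, and the
  candidate \<open>a\<^sup>i\<close>, the fuel \<open>a\<^sup>j\<close> and the reversed proof are cut out of a single string
  \<open>a\<^sup>i b a\<^sup>j b \<dots>\<close> that runs through all strings.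
\<close>

section \<open>Program fragments\<close>

text \<open>With the final state as a variable, the rule applies to any target state and leaves an
  equation of states as a goal.\<close>

lemma exec_PushI: "t = s(r := a # s r) \<Longrightarrow> exec (Push r a) s t"
  by (simp add: exec.Push)

lemma exec_PopI: "t = s(r := tl (s r)) \<Longrightarrow> exec (Pop r) s t"
  by (simp add: exec.Pop)

section \<open>Elementary stack operations and branching on a character\<close>

fun pushes :: "nat \<Rightarrow> string \<Rightarrow> program" where
  "pushes r [] = Skip"
| "pushes r (a # w) = Seq (pushes r w) (Push r a)"

lemma exec_pushes: "exec (pushes r w) s (s(r := w @ s r))"
proof (induction w)
  case (Cons a w)
  then show ?case by (auto intro!: exec.Seq[OF Cons] exec_PushI)
qed (simp add: exec.Skip)

definition clear :: "nat \<Rightarrow> program" where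
  "clear r = While r (Pop r)"

text \<open>Writing the content as an explicit update lets the induction run over that content with
  \<open>s\<close> fixed. The later loop lemmas use the same form and recover the plain one through
  \<open>fun_upd_triv\<close>.\<close>

lemma exec_clear_upd: "exec (clear r) (s(r := w)) (s(r := []))"
proof (induction w)
  case Nil
  show ?case unfolding clear_def by (simp add: exec.WhileDone)
next
  case (Cons a w)
  have "exec (Pop r) (s(r := a # w)) (s(r := w))"
    by (intro exec_PopI) simp
  moreover have "(s(r := a # w)) r \<noteq> []" by simp
  ultimately show ?case
    using Cons unfolding clear_def by (blast intro: exec.WhileStep)
qed

lemma exec_clear: "exec (clear r) s (s(r := []))"
  using exec_clear_upd[of r s "s r"] by (simp only: fun_upd_triv)

fun clear_all :: "nat list \<Rightarrow> program" where
  "clear_all [] = Skip"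
| "clear_all (r # rs) = Seq (clear r) (clear_all rs)"

lemma exec_clear_all: "exec (clear_all rs) s (\<lambda>r. if r \<in> set rs then [] else s r)"
proof (induction rs arbitrary: s)
  case (Cons q rs)
  have "(\<lambda>r. if r \<in> set rs then [] else (s(q := [])) r)
      = (\<lambda>r. if r \<in> set (q # rs) then [] else s r)"
    by auto
  then show ?case
    using exec.Seq[OF exec_clear[of q s] Cons[of "s(q := [])"]] by simp
qed (simp add: exec.Skip)

fun switch_among :: "char list \<Rightarrow> nat \<Rightarrow> (char \<Rightarrow> program) \<Rightarrow> program" where
  "switch_among [] r f = Skip"
| "switch_among (a # as) r f = IfHead r a (f a) (switch_among as r f)"

text \<open>\<open>IfHead\<close> compares with one fixed character only, so branching on the
  current character is a chain of 256 tests.\<close>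

definition switch :: "nat \<Rightarrow> (char \<Rightarrow> program) \<Rightarrow> program" where
  "switch = switch_among (map char_of [0..<256::nat])"

lemma exec_switch_among:
  assumes "s r = a # w" "exec (f a) s t" "a \<in> set as"
  shows "exec (switch_among as r f) s t"
  using assms(3)
proof (induction as)
  case (Cons b bs)
  show ?case
  proof (cases "a = b")
    case True
    then show ?thesis using assms by (auto intro: exec.IfTrue)
  next
    case False
    then show ?thesis using assms Cons by (auto intro: exec.IfFalse)
  qed
qed simp

lemma exec_switch:
  assumes "s r = a # w" "exec (f a) s t"
  shows "exec (switch r f) s t"
  unfolding switch_def using assms by (rule exec_switch_among) (simp flip: UNIV_char_of_nat)

definition move :: "nat \<Rightarrow> nat \<Rightarrow> program" where
  "move r d = While r (switch r (\<lambda>a. Seq (Pop r) (Push d a)))"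

lemma exec_move_upd:
  assumes "r \<noteq> d"
  shows "exec (move r d) (s(r := w, d := x)) (s(r := [], d := rev w @ x))"
proof (induction w arbitrary: x)
  case Nil
  show ?case unfolding move_def using assms by (simp add: exec.WhileDone)
next
  case (Cons a w)
  let ?s = "s(r := a # w, d := x)"
  have "exec (switch r (\<lambda>a. Seq (Pop r) (Push d a))) ?s (s(r := w, d := a # x))"
    using assms
    by (intro exec_switch[of _ _ a w] exec.Seq[OF exec_PopI[OF refl]] exec_PushI)
      (simp_all add: fun_upd_twist)
  moreover have "?s r \<noteq> []" using assms by simp
  ultimately show ?case
    using Cons[of "a # x"] unfolding move_def rev.simps append_assoc append.simps
    by (blast intro: exec.WhileStep)
qed

lemma exec_move:
  assumes "r \<noteq> d"
  shows "exec (move r d) s (s(r := [], d := rev (s r) @ s d))"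
  using exec_move_upd[OF assms, of s "s r" "s d"] by (simp only: fun_upd_triv)

text \<open>Reading a register destroys it. A copy is therefore made in two passes through a scratch
  register, one of them writing to two targets; the reversals of the two passes cancel.\<close>

definition move2 :: "nat \<Rightarrow> nat \<Rightarrow> nat \<Rightarrow> program" where
  "move2 r d e = While r (switch r (\<lambda>a. Seq (Pop r) (Seq (Push d a) (Push e a))))"

lemma exec_move2_upd:
  assumes "r \<noteq> d" "r \<noteq> e" "d \<noteq> e"
  shows "exec (move2 r d e) (s(r := w, d := x, e := y)) (s(r := [], d := rev w @ x, e := rev w @ y))"
proof (induction w arbitrary: x y)
  case Nil
  show ?case unfolding move2_def using assms by (simp add: exec.WhileDone)
next
  case (Cons a w)
  let ?s = "s(r := a # w, d := x, e := y)"
  have "exec (switch r (\<lambda>a. Seq (Pop r) (Seq (Push d a) (Push e a)))) ?s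
      (s(r := w, d := a # x, e := a # y))"
    using assms
    by (intro exec_switch[of _ _ a w] exec.Seq[OF exec_PopI[OF refl]]
        exec.Seq[OF exec_PushI[OF refl]] exec_PushI)
      (simp_all add: fun_upd_twist)
  moreover have "?s r \<noteq> []" using assms by simp
  ultimately show ?case
    using Cons[of "a # x" "a # y"] unfolding move2_def rev.simps append_assoc append.simps
    by (blast intro: exec.WhileStep)
qed

lemma exec_move2:
  assumes "r \<noteq> d" "r \<noteq> e" "d \<noteq> e"
  shows "exec (move2 r d e) s (s(r := [], d := rev (s r) @ s d, e := rev (s r) @ s e))"
  using exec_move2_upd[OF assms, of s "s r" "s d" "s e"] by (simp only: fun_upd_triv)

section \<open>Unary numbers and splitting at separators\<close>

abbreviation tally :: "nat \<Rightarrow> string" where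
  "tally n \<equiv> replicate n (CHR ''a'')"

text \<open>The loop ends after \<open>K\<close> because \<open>K\<close> is meant to empty register \<open>r\<close>.\<close>

definition split_tally :: "nat \<Rightarrow> nat \<Rightarrow> program \<Rightarrow> program" where
  "split_tally r d K = While r (IfHead r (CHR ''a'')
     (Seq (Pop r) (Push d (CHR ''a''))) (Seq (Pop r) K))"

lemma exec_split_tally_step:
  assumes "r \<noteq> d" "exec (split_tally r d K) (s(r := w, d := CHR ''a'' # x)) t"
  shows "exec (split_tally r d K) (s(r := CHR ''a'' # w, d := x)) t"
  unfolding split_tally_def
proof (rule exec.WhileStep)
  let ?s = "s(r := CHR ''a'' # w, d := x)"
  show "exec (IfHead r (CHR ''a'') (Seq (Pop r) (Push d (CHR ''a''))) (Seq (Pop r) K)) ?s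
      (s(r := w, d := CHR ''a'' # x))"
    using assms(1)
    by (intro exec.IfTrue[of _ _ _ w] exec.Seq[OF exec_PopI[OF refl] exec_PushI])
      (simp_all add: fun_upd_twist)
qed (use assms in \<open>simp_all add: split_tally_def\<close>)

text \<open>Without a separator the loop runs to the end of the string and never enters
  \<open>K\<close>.\<close>

lemma exec_split_tally_all:
  assumes "r \<noteq> d"
  shows "exec (split_tally r d K) (s(r := tally i, d := x)) (s(r := [], d := tally i @ x))"
proof (induction i arbitrary: x)
  case 0
  show ?case unfolding split_tally_def using assms by (simp add: exec.WhileDone)
next
  case (Suc i)
  show ?case
    using exec_split_tally_step[OF assms Suc]
    unfolding replicate_Suc append_Cons replicate_app_Cons_same .
qed

lemma exec_split_tally:
  assumes "r \<noteq> d" "b \<noteq> CHR ''a''"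
    and "exec K (s(r := w, d := tally i @ x)) t" "t r = []"
  shows "exec (split_tally r d K) (s(r := tally i @ b # w, d := x)) t"
  using assms(3)
proof (induction i arbitrary: x)
  case 0
  let ?s = "s(r := b # w, d := x)"
  have "?s(r := w) = s(r := w, d := x)" using assms(1) by (simp add: fun_upd_twist)
  with 0 have "exec K (?s(r := w)) t" by (metis append_Nil replicate_0)
  then have "exec (Seq (Pop r) K) ?s t"
    using assms(1) by (intro exec.Seq[OF exec_PopI[OF refl]]) simp
  with assms have "exec (IfHead r (CHR ''a'') (Seq (Pop r) (Push d (CHR ''a''))) (Seq (Pop r) K)) ?s t"
    by (intro exec.IfFalse) simp_all
  moreover have "exec (split_tally r d K) t t"
    unfolding split_tally_def using assms(4) by (rule exec.WhileDone)
  moreover have "?s r \<noteq> []" using assms(1) by simp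
  ultimately show ?case
    unfolding split_tally_def replicate_0 append_Nil by (blast intro: exec.WhileStep)
next
  case (Suc i)
  then have "exec (split_tally r d K) (s(r := tally i @ b # w, d := CHR ''a'' # x)) t"
    by (intro Suc.IH) (simp add: replicate_app_Cons_same)
  from exec_split_tally_step[OF assms(1) this] show ?case
    unfolding replicate_Suc append_Cons .
qed

text \<open>The alternatives match the two preceding loop lemmas, so that any string, well-formed or
  not, can be split.\<close>

lemma tally_cases:
  obtains i where "w = tally i" | i b v where "w = tally i @ b # v" "b \<noteq> CHR ''a''"
proof (induction w arbitrary: thesis)
  case Nil
  then show ?case by (metis replicate_0)
next
  case (Cons c w)
  show ?case
  proof (cases "c = CHR ''a''")
    case True
    then show ?thesis
      using Cons.prems Cons.IH by (metis append_Cons replicate_Suc)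
  next
    case False
    then show ?thesis using Cons.prems(2)[of 0] by simp
  qed
qed


section \<open>Enumeration of all strings\<close>

text \<open>Strings are bijective base-256 numerals, least significant digit first.\<close>

fun next_string :: "string \<Rightarrow> string" where
  "next_string [] = [char_of (0 :: nat)]"
| "next_string (a # w) =
     (if of_char a = (255 :: nat) then char_of (0 :: nat) # next_string w
      else char_of (Suc (of_char a)) # w)"

fun string_value :: "string \<Rightarrow> nat" where
  "string_value [] = 0"
| "string_value (a # w) = Suc (of_char a) + 256 * string_value w"

lemma string_value_next: "string_value (next_string w) = Suc (string_value w)"
proof (induction w)
  case (Cons a w)
  have "(of_char a :: nat) < 256" by (rule nat_of_char_less_256)
  moreover from this have "of_char a \<noteq> (255 :: nat) \<Longrightarrow> Suc (of_char a) < 256" by linarith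
  ultimately show ?case using Cons by auto
qed simp

text \<open>Digits range over 1 to 256, so after removing the \<open>Suc\<close> the residue modulo
  256 determines the first character.\<close>

lemma string_value_inject: "string_value v = string_value w \<Longrightarrow> v = w"
proof (induction v arbitrary: w)
  case Nil
  then show ?case by (cases w) auto
next
  case (Cons a v)
  then obtain b u where w: "w = b # u" by (cases w) auto
  have eq: "(of_char a :: nat) + 256 * string_value v = of_char b + 256 * string_value u"
    using Cons.prems unfolding w by simp
  from arg_cong[OF this, of "\<lambda>n. n mod 256"] have "(of_char a :: nat) = of_char b" by simp
  moreover from this eq have "string_value v = string_value u" by simp
  ultimately show ?case using Cons.IH w by simp
qed

text \<open>The \<open>k\<close>-th iterate has value \<open>k\<close>, so \<open>w\<close> is
  reached after \<open>string_value w\<close> steps.\<close>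

lemma ex_next_string_iterate: "\<exists>k. (next_string ^^ k) [] = w"
proof -
  have "string_value ((next_string ^^ k) []) = k" for k
    by (induction k) (simp_all add: string_value_next)
  then show ?thesis using string_value_inject by blast
qed

text \<open>Register \<open>g\<close> flags that the carry has not yet been absorbed.\<close>

definition carry_step :: "nat \<Rightarrow> nat \<Rightarrow> nat \<Rightarrow> program" where
  "carry_step r u g = switch r (\<lambda>a.
     if of_char a = (255 :: nat) then Seq (Pop r) (Push u (char_of (0 :: nat)))
     else Seq (Pop r) (Seq (Push u (char_of (Suc (of_char a)))) (Seq (Pop g) (move r u))))"

definition carry_end :: "nat \<Rightarrow> nat \<Rightarrow> program" where
  "carry_end u g = IfHead g (CHR ''a'') (Seq (Pop g) (Push u (char_of (0 :: nat)))) Skip"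

definition increment :: "nat \<Rightarrow> nat \<Rightarrow> nat \<Rightarrow> program" where
  "increment r u g = Seq (Push g (CHR ''a'')) (Seq (While r (carry_step r u g))
     (Seq (carry_end u g) (move u r)))"

text \<open>The loop and the flag test after it are treated together, because the state
  \<open>t\<close> between them depends on whether the carry was absorbed. If every digit
  overflowed, \<open>carry_end\<close> supplies the additional digit.\<close>

lemma exec_carry:
  assumes "distinct [r, u, g]"
  shows "\<exists>t. exec (While r (carry_step r u g)) (s(r := w, u := x, g := [CHR ''a''])) t \<and>
    exec (carry_end u g) t (s(r := [], u := rev (next_string w) @ x, g := []))"
proof (induction w arbitrary: x)
  case Nil
  let ?s = "s(r := [], u := x, g := [CHR ''a''])"
  have "exec (carry_end u g) ?s (s(r := [], u := char_of (0 :: nat) # x, g := []))"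
    unfolding carry_end_def using assms
    by (intro exec.IfTrue[of _ _ _ "[]"] exec.Seq[OF exec_PopI[OF refl]] exec_PushI)
      (simp_all add: fun_upd_twist)
  moreover have "exec (While r (carry_step r u g)) ?s ?s"
    using assms by (intro exec.WhileDone) simp
  moreover have "rev (next_string []) @ x = char_of (0 :: nat) # x" by simp
  ultimately show ?case by metis
next
  case (Cons a w)
  let ?s = "s(r := a # w, u := x, g := [CHR ''a''])"
  have ne: "?s r \<noteq> []" using assms by simp
  show ?case
  proof (cases "of_char a = (255 :: nat)")
    case True
    have "exec (carry_step r u g) ?s (s(r := w, u := char_of (0 :: nat) # x, g := [CHR ''a'']))"
      unfolding carry_step_def
    proof (rule exec_switch[of _ _ a w])
      show "exec (if of_char a = (255 :: nat) then Seq (Pop r) (Push u (char_of (0 :: nat)))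
          else Seq (Pop r) (Seq (Push u (char_of (Suc (of_char a)))) (Seq (Pop g) (move r u)))) ?s
          (s(r := w, u := char_of (0 :: nat) # x, g := [CHR ''a'']))"
        unfolding if_P[OF True] using assms
        by (intro exec.Seq[OF exec_PopI[OF refl]] exec_PushI) (simp add: fun_upd_twist)
    qed (use assms in simp)
    moreover have "rev (next_string w) @ char_of (0 :: nat) # x = rev (next_string (a # w)) @ x"
      using True by simp
    then obtain t where
      "exec (While r (carry_step r u g)) (s(r := w, u := char_of (0 :: nat) # x, g := [CHR ''a''])) t"
      "exec (carry_end u g) t (s(r := [], u := rev (next_string (a # w)) @ x, g := []))"
      using Cons[of "char_of (0 :: nat) # x"] by metis
    ultimately show ?thesis using ne by (blast intro: exec.WhileStep)
  next
    case False
    let ?b = "char_of (Suc (of_char a)) :: char"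
    let ?t = "s(r := [], u := rev (next_string (a # w)) @ x, g := [])"
    have "exec (move r u) ((s(g := []))(r := w, u := ?b # x))
        ((s(g := []))(r := [], u := rev w @ ?b # x))"
      using assms by (intro exec_move_upd) simp
    then have mv: "exec (move r u) (s(r := w, u := ?b # x, g := [])) ?t"
      using assms False by (simp add: fun_upd_twist)
    \<comment> \<open>The digit that absorbs the carry also ends the loop, as
      \<open>move r u\<close> empties \<open>r\<close>. The flag is then gone, so
      \<open>carry_end\<close> does nothing.\<close>
    have "exec (carry_step r u g) ?s ?t"
      unfolding carry_step_def
    proof (rule exec_switch[of _ _ a w])
      show "exec (if of_char a = (255 :: nat) then Seq (Pop r) (Push u (char_of (0 :: nat)))
          else Seq (Pop r) (Seq (Push u ?b) (Seq (Pop g) (move r u)))) ?s ?t"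
        unfolding if_not_P[OF False] using assms
        by (intro exec.Seq[OF exec_PopI[OF refl]] exec.Seq[OF exec_PushI[OF refl]]
          exec.Seq[OF exec_PopI mv]) (simp add: fun_upd_twist)
    qed (use assms in simp)
    moreover have "exec (While r (carry_step r u g)) ?t ?t"
      using assms by (intro exec.WhileDone) simp
    moreover have "exec (carry_end u g) ?t ?t"
      unfolding carry_end_def using assms by (intro exec.IfFalse exec.Skip) simp
    ultimately show ?thesis using ne by (blast intro: exec.WhileStep)
  qed
qed

lemma exec_increment:
  assumes "distinct [r, u, g]"
  shows "exec (increment r u g) (s(r := w, u := [], g := [])) (s(r := next_string w, u := [], g := []))"
proof -
  obtain t where t:
    "exec (While r (carry_step r u g)) (s(r := w, u := [], g := [CHR ''a''])) t"
    "exec (carry_end u g) t (s(r := [], u := rev (next_string w), g := []))"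
    using exec_carry[OF assms, of s w "[]"] by auto
  have "exec (move u r) ((s(g := []))(u := rev (next_string w), r := []))
      ((s(g := []))(u := [], r := rev (rev (next_string w)) @ []))"
    using assms by (intro exec_move_upd) simp
  then have "exec (move u r) (s(r := [], u := rev (next_string w), g := []))
      (s(r := next_string w, u := [], g := []))"
    using assms by (simp add: fun_upd_twist)
  with t have "exec (Seq (While r (carry_step r u g)) (Seq (carry_end u g) (move u r)))
      (s(r := w, u := [], g := [CHR ''a''])) (s(r := next_string w, u := [], g := []))"
    by (blast intro: exec.Seq)
  moreover have "exec (Push g (CHR ''a'')) (s(r := w, u := [], g := []))
      (s(r := w, u := [], g := [CHR ''a'']))"
    by (intro exec_PushI) simp
  ultimately show ?thesis
    unfolding increment_def by (blast intro: exec.Seq)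
qed


section \<open>Programs with bounded running time\<close>

text \<open>
  Each loop iteration consumes one character of register \<open>f\<close>. Once that is used up, a failure
  is recorded in register \<open>g\<close>, and loops only shorten their own control register, so that they
  all end.
\<close>

fun bounded :: "nat \<Rightarrow> nat \<Rightarrow> program \<Rightarrow> program" where
  "bounded f g (Seq P Q) = Seq (bounded f g P) (bounded f g Q)"
| "bounded f g (IfHead r a P Q) = IfHead r a (bounded f g P) (bounded f g Q)"
| "bounded f g (While r P) = While r (IfHead f (CHR ''a'')
     (Seq (Pop f) (bounded f g P)) (Seq (Push g (CHR ''a'')) (Pop r)))"
| "bounded f g P = P"

text \<open>Registers from \<open>width P\<close> on do not occur in \<open>P\<close> and are free
  for fuel, flag and scratch data.\<close>

fun width :: "program \<Rightarrow> nat" where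
  "width Skip = 0"
| "width (Push r a) = Suc r"
| "width (Pop r) = Suc r"
| "width (Seq P Q) = max (width P) (width Q)"
| "width (IfHead r a P Q) = max (Suc r) (max (width P) (width Q))"
| "width (While r P) = max (Suc r) (width P)"

definition merge :: "nat \<Rightarrow> state \<Rightarrow> state \<Rightarrow> state" where
  "merge N s e = (\<lambda>r. if r < N then s r else e r)"

lemma merge_low: "r < N \<Longrightarrow> merge N s e r = s r"
  and merge_high: "N \<le> r \<Longrightarrow> merge N s e r = e r"
  and merge_upd_low: "r < N \<Longrightarrow> (merge N s e)(r := w) = merge N (s(r := w)) e"
  and merge_upd_high: "N \<le> r \<Longrightarrow> (merge N s e)(r := w) = merge N s (e(r := w))"
  by (auto simp: merge_def)

lemma exec_Push_merge: "r < N \<Longrightarrow> exec (Push r a) (merge N s e) (merge N (s(r := a # s r)) e)"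
  by (rule exec_PushI) (simp only: merge_upd_low merge_low)

lemma exec_Pop_merge: "r < N \<Longrightarrow> exec (Pop r) (merge N s e) (merge N (s(r := tl (s r))) e)"
  by (rule exec_PopI) (simp only: merge_upd_low merge_low)

text \<open>Completeness of the simulation: a halting run consumes a fixed amount \<open>m\<close>
  of fuel, one unit per loop iteration. The arbitrary rest \<open>j\<close> lets these amounts add
  up under composition, and \<open>e\<close> passes the failure flag through unchanged.\<close>

lemma exec_bounded:
  assumes "exec P s t" "width P \<le> N" "N \<le> f"
  shows "\<exists>m. \<forall>j e. exec (bounded f g P)
    (merge N s (e(f := tally (m + j)))) (merge N t (e(f := tally j)))"
  using assms(1,2)
proof (induction rule: exec.induct)
  case (Skip s)
  show ?case by (intro exI[of _ 0]) (auto intro: exec.Skip)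
next
  case (Push r a s)
  then show ?case
    unfolding bounded.simps by (intro exI[of _ 0]) (simp only: add_0 width.simps Suc_le_eq exec_Push_merge, simp)
next
  case (Pop r s)
  then show ?case
    unfolding bounded.simps by (intro exI[of _ 0]) (simp only: add_0 width.simps Suc_le_eq exec_Pop_merge, simp)
next
  case (Seq P s t Q u)
  then have "width P \<le> N" "width Q \<le> N" by simp_all
  with Seq.IH obtain m m' where
    "\<forall>j e. exec (bounded f g P) (merge N s (e(f := tally (m + j)))) (merge N t (e(f := tally j)))"
    "\<forall>j e. exec (bounded f g Q) (merge N t (e(f := tally (m' + j)))) (merge N u (e(f := tally j)))"
    by blast
  then show ?case
    unfolding bounded.simps by (intro exI[of _ "m + m'"]) (simp only: add.assoc, blast intro: exec.Seq)
next
  case (IfTrue s r a w P t Q)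
  then have "width P \<le> N" by simp
  with IfTrue.IH obtain m where
    "\<forall>j e. exec (bounded f g P) (merge N s (e(f := tally (m + j)))) (merge N t (e(f := tally j)))"
    by blast
  moreover have "merge N s x r = a # w" for x
    using IfTrue by (simp add: merge_low)
  ultimately show ?case
    unfolding bounded.simps by (blast intro: exec.IfTrue)
next
  case (IfFalse s r a Q t P)
  then have "width Q \<le> N" by simp
  with IfFalse.IH obtain m where
    "\<forall>j e. exec (bounded f g Q) (merge N s (e(f := tally (m + j)))) (merge N t (e(f := tally j)))"
    by blast
  moreover have "\<nexists>w. merge N s x r = a # w" for x
    using IfFalse by (simp add: merge_low)
  ultimately show ?case
    unfolding bounded.simps by (blast intro: exec.IfFalse)
next
  case (WhileDone s r P)
  then show ?case
    by (intro exI[of _ 0]) (auto intro!: exec.WhileDone simp: merge_low)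
next
  case (WhileStep s r P t u)
  then have "width P \<le> N" by simp
  with WhileStep.IH WhileStep.prems obtain m m' where
    m: "\<And>j e. exec (bounded f g P) (merge N s (e(f := tally (m + j)))) (merge N t (e(f := tally j)))"
    and m': "\<And>j e. exec (bounded f g (While r P))
      (merge N t (e(f := tally (m' + j)))) (merge N u (e(f := tally j)))"
    by blast
  \<comment> \<open>The additional unit pays for the iteration at hand.\<close>
  have "exec (bounded f g (While r P)) (merge N s (e(f := tally (Suc (m + m') + j))))
      (merge N u (e(f := tally j)))" for j e
  proof -
    have "exec (Seq (Pop f) (bounded f g P)) (merge N s (e(f := tally (Suc (m + m') + j))))
        (merge N t (e(f := tally (m' + j))))"
      using m[of e "m' + j"] assms(3)
      by (intro exec.Seq[OF exec_PopI[OF refl]])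
        (simp add: merge_high merge_upd_high add.assoc)
    then have "exec (IfHead f (CHR ''a'') (Seq (Pop f) (bounded f g P))
          (Seq (Push g (CHR ''a'')) (Pop r)))
        (merge N s (e(f := tally (Suc (m + m') + j)))) (merge N t (e(f := tally (m' + j))))"
      using assms(3) by (intro exec.IfTrue) (simp_all add: merge_high)
    moreover have "merge N s (e(f := tally (Suc (m + m') + j))) r \<noteq> []"
      using WhileStep.hyps(1) WhileStep.prems by (simp add: merge_low)
    ultimately show ?thesis
      using m'[of e j] unfolding bounded.simps by (blast intro: exec.WhileStep)
  qed
  then show ?case by blast
qed

text \<open>Failures are only ever added, so an unchanged count certifies that no loop ran out of
  fuel and that \<open>t\<close> is the result of a genuine run.\<close>

definition bounded_run ::
  "nat \<Rightarrow> nat \<Rightarrow> nat \<Rightarrow> state \<Rightarrow> program \<Rightarrow> state \<Rightarrow> nat \<Rightarrow> nat \<Rightarrow> state \<Rightarrow> nat \<Rightarrow> nat \<Rightarrow> bool" where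
  "bounded_run N f g e P s j k t j' k' \<longleftrightarrow>
     exec (bounded f g P) (merge N s (e(f := tally j, g := tally k)))
       (merge N t (e(f := tally j', g := tally k'))) \<and>
     j' \<le> j \<and> k \<le> k' \<and> (k' = k \<longrightarrow> exec P s t)"

section \<open>Termination and soundness of the fuel simulation\<close>

context
  fixes N f g :: nat and e :: state
  assumes fg: "N \<le> f" "N \<le> g" "f \<noteq> g"
begin

lemma bounded_run_Seq:
  assumes "bounded_run N f g e P s j k t j1 k1" "bounded_run N f g e Q t j1 k1 u j2 k2"
  shows "bounded_run N f g e (Seq P Q) s j k u j2 k2"
proof -
  \<comment> \<open>Counts are monotone, so an unchanged total makes both parts free of
    failures.\<close>
  have "k2 = k \<Longrightarrow> k1 = k \<and> k2 = k1" using assms unfolding bounded_run_def by linarith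
  with assms show ?thesis
    unfolding bounded_run_def bounded.simps using exec.Seq le_trans by blast
qed

lemma bounded_run_IfHead:
  assumes "bounded_run N f g e (if \<exists>w. s r = a # w then P else Q) s j k t j' k'" "r < N"
  shows "bounded_run N f g e (IfHead r a P Q) s j k t j' k'"
proof (cases "\<exists>w. s r = a # w")
  case True
  moreover from this have "\<exists>w. merge N s (e(f := tally j, g := tally k)) r = a # w"
    using assms(2) by (simp only: merge_low)
  ultimately show ?thesis
    using assms(1) unfolding bounded_run_def bounded.simps if_P[OF True]
    using exec.IfTrue by blast
next
  case False
  moreover from this have "\<nexists>w. merge N s (e(f := tally j, g := tally k)) r = a # w"
    using assms(2) by (simp only: merge_low) simp
  ultimately show ?thesis
    using assms(1) unfolding bounded_run_def bounded.simps if_not_P[OF False]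
    using exec.IfFalse by blast
qed

lemma bounded_run_While_done:
  assumes "s r = []" "r < N"
  shows "bounded_run N f g e (While r P) s j k s j k"
proof -
  have "merge N s (e(f := tally j, g := tally k)) r = []"
    using assms by (simp only: merge_low)
  with assms(1) show ?thesis
    unfolding bounded_run_def bounded.simps using exec.WhileDone by blast
qed

lemma bounded_run_While_starved:
  assumes "s r \<noteq> []" "r < N" "bounded_run N f g e (While r P) (s(r := tl (s r))) 0 (Suc k) t j' k'"
  shows "bounded_run N f g e (While r P) s 0 k t j' k'"
proof -
  let ?s = "merge N s (e(f := tally 0, g := tally k))"
  let ?t = "merge N (s(r := tl (s r))) (e(f := tally 0, g := tally (Suc k)))"
  have "exec (Push g (CHR ''a'')) ?s (merge N s (e(f := tally 0, g := tally (Suc k))))"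
    using fg by (intro exec_PushI) (simp add: merge_high merge_upd_high)
  moreover have "exec (Pop r) (merge N s (e(f := tally 0, g := tally (Suc k)))) ?t"
    using assms(2) by (rule exec_Pop_merge)
  moreover have "\<nexists>w. ?s f = CHR ''a'' # w"
    using fg by (simp add: merge_high)
  ultimately have "exec (IfHead f (CHR ''a'')
      (Seq (Pop f) (bounded f g P)) (Seq (Push g (CHR ''a'')) (Pop r))) ?s ?t"
    by (blast intro: exec.IfFalse exec.Seq)
  moreover have "?s r \<noteq> []" using assms by (simp only: merge_low not_False_eq_True)
  \<comment> \<open>The count has risen strictly, so the clause about genuine runs holds
    vacuously.\<close>
  moreover have "k' \<noteq> k" "k \<le> k'" using assms(3) unfolding bounded_run_def by simp_all
  ultimately show ?thesis
    using assms(3) unfolding bounded_run_def bounded.simps by (blast intro: exec.WhileStep)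
qed

lemma bounded_run_While_step:
  assumes "s r \<noteq> []" "r < N" "bounded_run N f g e P s j k t j1 k1"
    "bounded_run N f g e (While r P) t j1 k1 u j2 k2"
  shows "bounded_run N f g e (While r P) s (Suc j) k u j2 k2"
proof -
  let ?s = "merge N s (e(f := tally (Suc j), g := tally k))"
  have "exec (Pop f) ?s (merge N s (e(f := tally j, g := tally k)))"
    using fg by (intro exec_PopI) (simp add: merge_high merge_upd_high fun_upd_twist)
  moreover have "\<exists>w. ?s f = CHR ''a'' # w"
    using fg by (simp add: merge_high)
  ultimately have "exec (IfHead f (CHR ''a'')
      (Seq (Pop f) (bounded f g P)) (Seq (Push g (CHR ''a'')) (Pop r))) ?s
      (merge N t (e(f := tally j1, g := tally k1)))"
    using assms(3) unfolding bounded_run_def by (blast intro: exec.IfTrue exec.Seq)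
  moreover have "?s r \<noteq> []" using assms by (simp only: merge_low not_False_eq_True)
  ultimately have "exec (bounded f g (While r P)) ?s (merge N u (e(f := tally j2, g := tally k2)))"
    using assms(4) unfolding bounded_run_def bounded.simps by (blast intro: exec.WhileStep)
  moreover have "j2 \<le> Suc j" "k \<le> k2" "k2 = k \<Longrightarrow> k1 = k \<and> k2 = k1"
    using assms(3,4) unfolding bounded_run_def by linarith+
  moreover have "k2 = k \<Longrightarrow> exec (While r P) s u"
    using assms calculation(4) unfolding bounded_run_def by (blast intro: exec.WhileStep)
  ultimately show ?thesis unfolding bounded_run_def by blast
qed

text \<open>Loops end by lexicographic descent: an iteration with fuel lowers the fuel, and one
  without fuel shortens the control register while the fuel stays 0.\<close>

lemma bounded_halts:
  "width P \<le> N \<Longrightarrow> \<exists>t j' k'. bounded_run N f g e P s j k t j' k'"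
proof (induction P arbitrary: s j k)
  case Skip
  show ?case unfolding bounded_run_def bounded.simps using exec.Skip by blast
next
  case (Push r a)
  then have "r < N" by simp
  then show ?case
    unfolding bounded_run_def bounded.simps using exec_Push_merge exec.Push by blast
next
  case (Pop r)
  then have "r < N" by simp
  then show ?case
    unfolding bounded_run_def bounded.simps using exec_Pop_merge exec.Pop by blast
next
  case (Seq P Q)
  then have w: "width P \<le> N" "width Q \<le> N" by simp_all
  obtain t j1 k1 where 1: "bounded_run N f g e P s j k t j1 k1" using Seq.IH(1)[OF w(1)] by blast
  obtain u j2 k2 where "bounded_run N f g e Q t j1 k1 u j2 k2" using Seq.IH(2)[OF w(2)] by blast
  from bounded_run_Seq[OF 1 this] show ?case by blast
next
  case (IfHead r a P Q)
  then have "width P \<le> N" "width Q \<le> N" "r < N" by simp_all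
  with IfHead.IH have "\<exists>t j' k'. bounded_run N f g e (if \<exists>w. s r = a # w then P else Q) s j k t j' k'"
    by (cases "\<exists>w. s r = a # w") simp_all
  with \<open>r < N\<close> bounded_run_IfHead show ?case by blast
next
  case (While r P)
  then have r: "r < N" and P: "width P \<le> N" by simp_all
  show ?case
  proof (induction "(j, length (s r))" arbitrary: j k s
      rule: wf_induct_rule[OF wf_lex_prod[OF wf_less_than wf_less_than]])
    case 1
    consider "s r = []" | "s r \<noteq> []" "j = 0" | i where "s r \<noteq> []" "j = Suc i"
      by (cases j) auto
    then show ?case
    proof cases
      case 1
      then show ?thesis using r bounded_run_While_done by blast
    next
      case 2
      then have "((0, length ((s(r := tl (s r))) r)), (j, length (s r))) \<in> less_than <*lex*> less_than"
        by simp
      from 1(1)[of 0 "s(r := tl (s r))" "Suc k", OF this] show ?thesis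
        using 2 r bounded_run_While_starved by blast
    next
      case (3 i)
      from While.IH[OF P] obtain t j1 k1 where t: "bounded_run N f g e P s i k t j1 k1" by blast
      \<comment> \<open>The body may lengthen register \<open>r\<close>, but it never adds fuel, so
        \<open>j1 \<le> i < j\<close>.\<close>
      then have "((j1, length (t r)), (j, length (s r))) \<in> less_than <*lex*> less_than"
        using 3 unfolding bounded_run_def by auto
      from 1(1)[of j1 t k1, OF this] show ?thesis
        using 3 r t bounded_run_While_step by blast
    qed
  qed
qed

end


section \<open>The search program\<close>

text \<open>
  Above the \<open>N\<close> registers of the checker: its fuel, its failure flag, the enumerated string,
  two scratch registers, the candidate, and the control register of the main loop.
\<close>

definition config :: "nat \<Rightarrow> state \<Rightarrow> string \<Rightarrow> string \<Rightarrow> string \<Rightarrow> string \<Rightarrow> string \<Rightarrow> string \<Rightarrow> string \<Rightarrow> state" where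
  "config N s f g w v u x l = merge N s (\<lambda>r. if r = N then f else if r = N + 1 then g
     else if r = N + 2 then w else if r = N + 3 then v else if r = N + 4 then u
     else if r = N + 5 then x else if r = N + 6 then l else [])"

lemma config_apply:
  "r < N \<Longrightarrow> config N s f g w v u x l r = s r"
  "config N s f g w v u x l N = f"
  "config N s f g w v u x l (N + 1) = g"
  "config N s f g w v u x l (N + 2) = w"
  "config N s f g w v u x l (N + 3) = v"
  "config N s f g w v u x l (N + 4) = u"
  "config N s f g w v u x l (N + 5) = x"
  "config N s f g w v u x l (N + 6) = l"
  by (simp_all add: config_def merge_def)

lemma config_upd:
  "r < N \<Longrightarrow> (config N s f g w v u x l)(r := y) = config N (s(r := y)) f g w v u x l"
  "(config N s f g w v u x l)(N := y) = config N s y g w v u x l"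
  "(config N s f g w v u x l)(N + 1 := y) = config N s f y w v u x l"
  "(config N s f g w v u x l)(N + 2 := y) = config N s f g y v u x l"
  "(config N s f g w v u x l)(N + 3 := y) = config N s f g w y u x l"
  "(config N s f g w v u x l)(N + 4 := y) = config N s f g w v y x l"
  "(config N s f g w v u x l)(N + 5 := y) = config N s f g w v u y l"
  "(config N s f g w v u x l)(N + 6 := y) = config N s f g w v u x y"
  by (auto simp: config_def merge_def fun_eq_iff)

text \<open>Translates between the \<open>merge\<close> form of the simulation lemmas and the
  \<open>config\<close> form of the search.\<close>

lemma config_merge:
  "merge N s ((config N s' f' g' w v u x l)(N := f, N + 1 := g)) = config N s f g w v u x l"
  "merge N s ((config N s' f' g w v u x l)(N := f)) = config N s f g w v u x l"
  by (auto simp: config_def merge_def fun_eq_iff)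

section \<open>Decoding a string into candidate, fuel and proof\<close>

definition decode :: "nat \<Rightarrow> program" where
  "decode N = Seq (move (N + 2) (N + 4)) (Seq (move2 (N + 4) (N + 2) (N + 3))
     (split_tally (N + 3) (N + 5) (split_tally (N + 3) N (move (N + 3) 1))))"

text \<open>Splitting works on a copy in register \<open>N + 3\<close>; the original stays in
  \<open>N + 2\<close> to be incremented after a failure.\<close>

lemma exec_decode_copy:
  assumes "exec (split_tally (N + 3) (N + 5) (split_tally (N + 3) N (move (N + 3) 1)))
    (config N s f g w w [] x l) t"
  shows "exec (decode N) (config N s f g w [] [] x l) t"
proof -
  have "exec (move (N + 2) (N + 4)) (config N s f g w [] [] x l) (config N s f g [] [] (rev w) x l)"
    using exec_move[of "N + 2" "N + 4" "config N s f g w [] [] x l"]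
    by (simp only: config_apply config_upd append_Nil2)
  moreover have "exec (move2 (N + 4) (N + 2) (N + 3)) (config N s f g [] [] (rev w) x l)
      (config N s f g w w [] x l)"
    using exec_move2[of "N + 4" "N + 2" "N + 3" "config N s f g [] [] (rev w) x l"]
    by (simp only: config_apply config_upd append_Nil2 rev_rev_ident)
  ultimately show ?thesis
    unfolding decode_def using assms by (blast intro: exec.Seq)
qed

abbreviation blank :: state where
  "blank \<equiv> \<lambda>_. []"

lemma exec_split_fuel:
  assumes "2 \<le> N" "b \<noteq> CHR ''a''"
  shows "exec (split_tally (N + 3) N (move (N + 3) 1))
      (config N blank [] [] w (tally j @ b # v) [] x l)
      (config N (blank(1 := rev v)) (tally j) [] w [] [] x l)"
proof -
  let ?s = "config N blank [] [] w [] [] x l"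
  have mv: "exec (move (N + 3) 1) (config N blank (tally j) [] w v [] x l)
      (config N (blank(1 := rev v)) (tally j) [] w [] [] x l)"
    using exec_move[of "N + 3" 1 "config N blank (tally j) [] w v [] x l"] assms(1)
    by (simp add: config_apply config_upd del: fun_upd_apply)
  have "exec (split_tally (N + 3) N (move (N + 3) 1)) (?s(N + 3 := tally j @ b # v, N := []))
      (config N (blank(1 := rev v)) (tally j) [] w [] [] x l)"
    using mv assms by (intro exec_split_tally) (simp_all only: config_apply config_upd append_Nil2, simp)
  then show "exec (split_tally (N + 3) N (move (N + 3) 1))
      (config N blank [] [] w (tally j @ b # v) [] x l)
      (config N (blank(1 := rev v)) (tally j) [] w [] [] x l)"
    by (simp only: config_upd)
qed

lemma exec_split_fuel_all:
  "exec (split_tally (N + 3) N (move (N + 3) 1))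
    (config N blank [] [] w (tally j) [] x l)
    (config N blank (tally j) [] w [] [] x l)"
proof -
  let ?s = "config N blank [] [] w [] [] x l"
  have "exec (split_tally (N + 3) N (move (N + 3) 1)) (?s(N + 3 := tally j, N := []))
      (?s(N + 3 := [], N := tally j @ []))"
    by (intro exec_split_tally_all) simp
  then show ?thesis by (simp only: config_upd append_Nil2)
qed

lemma exec_decode_parts:
  assumes "b \<noteq> CHR ''a''"
    and "exec (split_tally (N + 3) N (move (N + 3) 1))
      (config N blank [] [] (tally i @ b # v) v [] (tally i) l) t" "t (N + 3) = []"
  shows "exec (decode N) (config N blank [] [] (tally i @ b # v) [] [] [] l) t"
proof -
  let ?w = "tally i @ b # v"
  have "exec (split_tally (N + 3) (N + 5) (split_tally (N + 3) N (move (N + 3) 1)))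
      ((config N blank [] [] ?w [] [] [] l)(N + 3 := ?w, N + 5 := [])) t"
    using assms by (intro exec_split_tally) (simp_all only: config_upd append_Nil2, simp)
  then show ?thesis
    by (intro exec_decode_copy) (simp only: config_upd)
qed

text \<open>The last \<open>move\<close> reverses the rest of the string, hence \<open>rev p\<close>
  in the code. Every triple is thus obtained from some string.\<close>

lemma exec_decode_code:
  assumes "2 \<le> N" "w = tally i @ CHR ''b'' # tally j @ CHR ''b'' # rev p"
  shows "exec (decode N) (config N blank [] [] w [] [] [] l)
    (config N (blank(1 := p)) (tally j) [] w [] [] (tally i) l)"
  unfolding assms(2)
proof (rule exec_decode_parts)
  show "exec (split_tally (N + 3) N (move (N + 3) 1))
      (config N blank [] [] (tally i @ CHR ''b'' # tally j @ CHR ''b'' # rev p)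
        (tally j @ CHR ''b'' # rev p) [] (tally i) l)
      (config N (blank(1 := p)) (tally j) [] (tally i @ CHR ''b'' # tally j @ CHR ''b'' # rev p)
        [] [] (tally i) l)"
    using exec_split_fuel[OF assms(1), of "CHR ''b''" _ j "rev p"]
    unfolding rev_rev_ident by simp
qed (simp_all only: config_apply, simp)

text \<open>Malformed strings decode too: without a first separator the fuel is 0 and the proof
  empty, without a second one the proof is empty. Any character other than \<open>a\<close>
  separates.\<close>

lemma exec_decode:
  assumes "2 \<le> N"
  shows "\<exists>i j p. exec (decode N) (config N blank [] [] w [] [] [] l)
    (config N (blank(1 := p)) (tally j) [] w [] [] (tally i) l)"
proof -
  have blank: "blank(1 := []) = blank" by auto
  show ?thesis
  proof (cases w rule: tally_cases)
    case (1 i)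
    have "exec (split_tally (N + 3) (N + 5) (split_tally (N + 3) N (move (N + 3) 1)))
        ((config N blank [] [] w [] [] [] l)(N + 3 := w, N + 5 := []))
        ((config N blank [] [] w [] [] [] l)(N + 3 := [], N + 5 := tally i @ []))"
      unfolding 1 by (intro exec_split_tally_all) simp
    then have "exec (decode N) (config N blank [] [] w [] [] [] l)
        (config N blank (tally 0) [] w [] [] (tally i) l)"
      by (intro exec_decode_copy) (simp only: config_upd append_Nil2 replicate_0)
    then show ?thesis using blank by metis
  next
    case (2 i b v)
    have "\<exists>j p. exec (split_tally (N + 3) N (move (N + 3) 1))
        (config N blank [] [] w v [] (tally i) l)
        (config N (blank(1 := p)) (tally j) [] w [] [] (tally i) l)"
    proof (cases v rule: tally_cases)
      case (1 j)
      have "exec (split_tally (N + 3) N (move (N + 3) 1))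
          (config N blank [] [] w v [] (tally i) l)
          (config N (blank(1 := [])) (tally j) [] w [] [] (tally i) l)"
        unfolding 1 blank by (rule exec_split_fuel_all)
      then show ?thesis by blast
    next
      case (2 j c v')
      then show ?thesis using exec_split_fuel[OF assms] by blast
    qed
    then obtain j p where "exec (split_tally (N + 3) N (move (N + 3) 1))
        (config N blank [] [] w v [] (tally i) l)
        (config N (blank(1 := p)) (tally j) [] w [] [] (tally i) l)" by blast
    from exec_decode_parts[OF 2(2) this[unfolded 2(1)]] show ?thesis
      unfolding 2(1) config_apply by blast
  qed
qed

text \<open>
  The bound \<open>10 ^ k\<close> has \<open>k + 1\<close> decimal digits, which can be pushed one by one
  without exceeding it.
\<close>

lemma decimal_power: "decimal (10 ^ k) = CHR ''1'' # replicate k (CHR ''0'')"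
proof (induction k)
  case 0
  have "(of_char (CHR ''1'') :: nat) = 49" by simp
  then have "char_of (49 :: nat) = CHR ''1''" by (metis char_of_char)
  then show ?case by (subst decimal.simps) simp
next
  case (Suc k)
  have "(of_char (CHR ''0'') :: nat) = 48" by simp
  then have "char_of (48 :: nat) = CHR ''0''" by (metis char_of_char)
  then have "decimal (10 ^ Suc k) = decimal (10 ^ k) @ [CHR ''0'']"
    by (subst decimal.simps) simp
  with Suc show ?case by (simp add: replicate_append_same)
qed

definition build_statement :: "nat \<Rightarrow> nat \<Rightarrow> program" where
  "build_statement N k =
     Seq (pushes 0 ('' is of length >1'' @ replicate k (CHR ''0'')))
       (Seq (move2 (N + 5) 0 (N + 4)) (Seq (move (N + 4) (N + 5))
         (pushes 0 ''every algorithm that outputs '')))"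

text \<open>Pushing prepends, so the statement is assembled from its right end. The candidate
  survives through a scratch copy, and reversals do not affect it because it repeats a single
  character.\<close>

lemma exec_build_statement:
  assumes "0 < N" "s 0 = []"
  shows "exec (build_statement N k) (config N s f g w v [] (tally i) l)
    (config N (s(0 := length_statement (tally i) (10 ^ k))) f g w v [] (tally i) l)"
proof -
  let ?a = "'' is of length >1'' @ replicate k (CHR ''0'')"
  let ?b = "''every algorithm that outputs ''"
  have eq: "?b @ tally i @ ?a = length_statement (tally i) (10 ^ k)"
    by (simp add: length_statement_def decimal_power)
  have "exec (pushes 0 ?a) (config N s f g w v [] (tally i) l)
      (config N (s(0 := ?a)) f g w v [] (tally i) l)"
    using exec_pushes[of 0 ?a "config N s f g w v [] (tally i) l"]
    unfolding config_apply(1)[OF assms(1)] config_upd(1)[OF assms(1)] assms(2) append_Nil2 .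
  moreover have "exec (move2 (N + 5) 0 (N + 4)) (config N (s(0 := ?a)) f g w v [] (tally i) l)
      (config N (s(0 := tally i @ ?a)) f g w v (tally i) [] l)"
    using exec_move2[of "N + 5" 0 "N + 4" "config N (s(0 := ?a)) f g w v [] (tally i) l"] assms(1)
    unfolding config_apply config_upd config_apply(1)[OF assms(1)] config_upd(1)[OF assms(1)]
      append_Nil2 rev_replicate fun_upd_upd fun_upd_same by simp
  moreover have "exec (move (N + 4) (N + 5)) (config N (s(0 := tally i @ ?a)) f g w v (tally i) [] l)
      (config N (s(0 := tally i @ ?a)) f g w v [] (tally i) l)"
    using exec_move[of "N + 4" "N + 5" "config N (s(0 := tally i @ ?a)) f g w v (tally i) [] l"]
    unfolding config_apply config_upd append_Nil2 rev_replicate by simp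
  moreover have "exec (pushes 0 ?b) (config N (s(0 := tally i @ ?a)) f g w v [] (tally i) l)
      (config N (s(0 := length_statement (tally i) (10 ^ k))) f g w v [] (tally i) l)"
    using exec_pushes[of 0 ?b "config N (s(0 := tally i @ ?a)) f g w v [] (tally i) l"]
    unfolding config_apply(1)[OF assms(1)] config_upd(1)[OF assms(1)] fun_upd_upd fun_upd_same eq .
  ultimately show ?thesis
    unfolding build_statement_def by (blast intro: exec.Seq)
qed

section \<open>Testing the answer and closing an attempt\<close>

definition test_answer :: "nat \<Rightarrow> program" where
  "test_answer N = Seq (IfHead 0 (CHR ''1'') (Pop 0) (Push (N + 1) (CHR ''a'')))
     (While 0 (Seq (Pop 0) (Push (N + 1) (CHR ''a''))))"

lemma exec_drain:
  assumes "0 < N"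
  shows "exec (While 0 (Seq (Pop 0) (Push (N + 1) (CHR ''a''))))
    (config N (s(0 := y)) f (tally k) w v u x l)
    (config N (s(0 := [])) f (tally (length y + k)) w v u x l)"
proof (induction y arbitrary: k)
  case Nil
  have "config N (s(0 := [])) f (tally k) w v u x l 0 = []"
    by (simp only: config_apply(1)[OF assms] fun_upd_same)
  then show ?case unfolding list.size(3) add_0 by (rule exec.WhileDone)
next
  case (Cons a y)
  have "exec (Pop 0) (config N (s(0 := a # y)) f (tally k) w v u x l)
      (config N (s(0 := y)) f (tally k) w v u x l)"
    by (rule exec_PopI)
      (simp only: config_apply(1)[OF assms] config_upd(1)[OF assms] fun_upd_same fun_upd_upd list.sel)
  moreover have "exec (Push (N + 1) (CHR ''a'')) (config N (s(0 := y)) f (tally k) w v u x l)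
      (config N (s(0 := y)) f (tally (Suc k)) w v u x l)"
    by (rule exec_PushI) (simp only: config_apply config_upd replicate_Suc)
  moreover have "config N (s(0 := a # y)) f (tally k) w v u x l 0 \<noteq> []"
    by (simp only: config_apply(1)[OF assms] fun_upd_same) simp
  moreover have "length (a # y) + k = length y + Suc k" by simp
  ultimately show ?case
    using Cons[of "Suc k"] by (simp only:) (blast intro: exec.Seq exec.WhileStep)
qed

text \<open>A wrong first character and every leftover character each add a failure. The flag then
  records both starvation and a wrong answer.\<close>

lemma exec_test_answer:
  assumes "0 < N"
  shows "\<exists>k'. exec (test_answer N) (config N s f (tally k) w v u x l)
      (config N (s(0 := [])) f (tally k') w v u x l) \<and> (k' = 0 \<longleftrightarrow> k = 0 \<and> s 0 = ''1'')"
proof (cases "\<exists>y. s 0 = CHR ''1'' # y")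
  case True
  then obtain y where y: "s 0 = CHR ''1'' # y" by blast
  have "exec (Pop 0) (config N s f (tally k) w v u x l) (config N (s(0 := y)) f (tally k) w v u x l)"
    by (rule exec_PopI)
      (simp only: config_apply(1)[OF assms] config_upd(1)[OF assms] y list.sel)
  moreover have "config N s f (tally k) w v u x l 0 = CHR ''1'' # y"
    using y by (simp only: config_apply(1)[OF assms])
  ultimately have "exec (test_answer N) (config N s f (tally k) w v u x l)
      (config N (s(0 := [])) f (tally (length y + k)) w v u x l)"
    unfolding test_answer_def using exec_drain[OF assms] by (blast intro: exec.Seq exec.IfTrue)
  then show ?thesis using y by (intro exI[of _ "length y + k"] conjI) auto
next
  case False
  have "exec (Push (N + 1) (CHR ''a'')) (config N s f (tally k) w v u x l)
      (config N (s(0 := s 0)) f (tally (Suc k)) w v u x l)"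
    by (rule exec_PushI) (simp only: config_apply config_upd replicate_Suc fun_upd_triv)
  moreover have "\<nexists>y. config N s f (tally k) w v u x l 0 = CHR ''1'' # y"
    using False by (simp only: config_apply(1)[OF assms] not_False_eq_True)
  ultimately have "exec (test_answer N) (config N s f (tally k) w v u x l)
      (config N (s(0 := [])) f (tally (length (s 0) + Suc k)) w v u x l)"
    unfolding test_answer_def using exec_drain[OF assms] by (blast intro: exec.Seq exec.IfFalse)
  then show ?thesis using False by (intro exI[of _ "length (s 0) + Suc k"] conjI) auto
qed

definition finish :: "nat \<Rightarrow> program" where
  "finish N = IfHead (N + 1) (CHR ''a'')
     (Seq (clear_all ([0..<N] @ [N, N + 1, N + 5])) (increment (N + 2) (N + 4) (N + 1)))
     (Seq (Pop (N + 6)) (move (N + 5) 0))"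

text \<open>The checker may leave anything below \<open>N\<close>; clearing it restores the shape in
  which the next attempt starts.\<close>

lemma exec_finish_failure:
  "exec (finish N) (config N s f (tally (Suc k)) w [] [] x l)
    (config N blank [] [] (next_string w) [] [] [] l)"
proof -
  let ?s = "config N s f (tally (Suc k)) w [] [] x l"
  let ?t = "config N blank [] [] w [] [] [] l"
  have "(\<lambda>r. if r \<in> set ([0..<N] @ [N, N + 1, N + 5]) then [] else ?s r) = ?t"
    by (auto simp: config_def merge_def fun_eq_iff)
  then have "exec (clear_all ([0..<N] @ [N, N + 1, N + 5])) ?s ?t"
    using exec_clear_all[of "[0..<N] @ [N, N + 1, N + 5]" ?s] by metis
  moreover have "exec (increment (N + 2) (N + 4) (N + 1)) (?t(N + 2 := w, N + 4 := [], N + 1 := []))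
      (?t(N + 2 := next_string w, N + 4 := [], N + 1 := []))"
    by (intro exec_increment) simp
  then have "exec (increment (N + 2) (N + 4) (N + 1)) ?t (config N blank [] [] (next_string w) [] [] [] l)"
    by (simp only: config_upd)
  moreover have "?s (N + 1) = CHR ''a'' # tally k" by (simp only: config_apply replicate_Suc)
  ultimately show ?thesis
    unfolding finish_def by (blast intro: exec.IfTrue exec.Seq)
qed

text \<open>Emptying the control register \<open>N + 6\<close> ends the main loop, and the candidate
  goes to register 0, where results are read.\<close>

lemma exec_finish_success:
  assumes "0 < N" "s 0 = []"
  shows "exec (finish N) (config N s f [] w [] [] (tally i) [c])
    (config N (s(0 := tally i)) f [] w [] [] [] [])"
proof -
  have "exec (Pop (N + 6)) (config N s f [] w [] [] (tally i) [c]) (config N s f [] w [] [] (tally i) [])"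
    by (rule exec_PopI) (simp only: config_apply config_upd list.sel)
  moreover have "exec (move (N + 5) 0) (config N s f [] w [] [] (tally i) [])
      (config N (s(0 := tally i)) f [] w [] [] [] [])"
    using exec_move[of "N + 5" 0 "config N s f [] w [] [] (tally i) []"] assms
    unfolding config_apply config_upd config_apply(1)[OF assms(1)] config_upd(1)[OF assms(1)]
      rev_replicate assms(2) append_Nil2 by simp
  moreover have "\<nexists>y. config N s f [] w [] [] (tally i) [c] (N + 1) = CHR ''a'' # y"
    by (simp only: config_apply) simp
  ultimately show ?thesis
    unfolding finish_def by (blast intro: exec.IfFalse exec.Seq)
qed

section \<open>The search loop\<close>

definition attempt :: "program \<Rightarrow> nat \<Rightarrow> nat \<Rightarrow> program" where
  "attempt C N k = Seq (decode N) (Seq (build_statement N k)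
     (Seq (bounded N (N + 1) C) (Seq (test_answer N) (finish N))))"

definition search :: "program \<Rightarrow> nat \<Rightarrow> nat \<Rightarrow> program" where
  "search C N k = Seq (Push (N + 6) (CHR ''a'')) (While (N + 6) (attempt C N k))"

abbreviation search_state :: "nat \<Rightarrow> string \<Rightarrow> state" where
  "search_state N w \<equiv> config N blank [] [] w [] [] [] ''a''"

text \<open>Decoding and simulation enter as premises, so the lemma serves both an arbitrary string
  and the one chosen to succeed.\<close>

lemma exec_attempt:
  fixes N k i :: nat and p :: string
  defines "s \<equiv> blank(1 := p, 0 := length_statement (tally i) (10 ^ k))"
  assumes "2 \<le> N"
    and "exec (decode N) (search_state N w)
      (config N (blank(1 := p)) (tally j) [] w [] [] (tally i) ''a'')"
    and "exec (bounded N (N + 1) C) (config N s (tally j) [] w [] [] (tally i) ''a'')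
      (config N t (tally j') (tally k') w [] [] (tally i) ''a'')"
  shows "if k' = 0 \<and> t 0 = ''1''
    then \<exists>u. exec (attempt C N k) (search_state N w) u \<and> u (N + 6) = [] \<and> u 0 = tally i
    else exec (attempt C N k) (search_state N w) (search_state N (next_string w))"
proof -
  have N: "0 < N" using assms(2) by simp
  have "exec (build_statement N k) (config N (blank(1 := p)) (tally j) [] w [] [] (tally i) ''a'')
      (config N s (tally j) [] w [] [] (tally i) ''a'')"
    unfolding s_def using N by (intro exec_build_statement) simp_all
  then have run: "exec (attempt C N k) (search_state N w) u"
    if "exec (Seq (test_answer N) (finish N))
      (config N t (tally j') (tally k') w [] [] (tally i) ''a'') u" for u
    unfolding attempt_def using assms(3,4) that by (blast intro: exec.Seq)
  obtain k'' where k'': "exec (test_answer N) (config N t (tally j') (tally k') w [] [] (tally i) ''a'')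
      (config N (t(0 := [])) (tally j') (tally k'') w [] [] (tally i) ''a'')"
    "k'' = 0 \<longleftrightarrow> k' = 0 \<and> t 0 = ''1''"
    using exec_test_answer[OF N] by blast
  show ?thesis
  proof (cases k'')
    case 0
    let ?u = "config N (t(0 := [], 0 := tally i)) (tally j') [] w [] [] [] []"
    have "exec (finish N) (config N (t(0 := [])) (tally j') (tally k'') w [] [] (tally i) ''a'') ?u"
      unfolding 0 replicate_0 using N by (intro exec_finish_success) simp_all
    with k''(1) have "exec (attempt C N k) (search_state N w) ?u"
      by (blast intro: run exec.Seq)
    moreover have "?u (N + 6) = []" "?u 0 = tally i"
      by (simp_all only: config_apply config_apply(1)[OF N] fun_upd_same)
    ultimately show ?thesis using k''(2) 0 by auto
  next
    case (Suc m)
    have "exec (attempt C N k) (search_state N w) (search_state N (next_string w))"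
      using k''(1) exec_finish_failure unfolding Suc by (blast intro: run exec.Seq)
    moreover have "\<not> (k' = 0 \<and> t 0 = ''1'')" using k''(2) Suc by simp
    ultimately show ?thesis by (simp only: if_False)
  qed
qed

lemma computes_pair: "computes C [x, y] z \<longleftrightarrow> (\<exists>t. exec C (blank(1 := y, 0 := x)) t \<and> t 0 = z)"
proof -
  have "(\<lambda>i. if i < length [x, y] then [x, y] ! i else []) = blank(1 := y, 0 := x)"
    by (auto simp: fun_eq_iff less_Suc_eq nth_Cons')
  then show ?thesis unfolding computes_def by simp
qed

text \<open>The simulation always halts, so no attempt blocks the search; and the search stops only
  on a simulation without failures, that is, on a genuine acceptance by \<open>C\<close>.\<close>

lemma attempt_cases:
  assumes "2 \<le> N" "width C \<le> N"
  shows "exec (attempt C N k) (search_state N w) (search_state N (next_string w)) \<or>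
    (\<exists>u i p. exec (attempt C N k) (search_state N w) u \<and> u (N + 6) = [] \<and> u 0 = tally i \<and>
      computes C [length_statement (tally i) (10 ^ k), p] ''1'')"
proof -
  obtain i j p where d: "exec (decode N) (search_state N w)
      (config N (blank(1 := p)) (tally j) [] w [] [] (tally i) ''a'')"
    using exec_decode[OF assms(1)] by blast
  let ?s = "blank(1 := p, 0 := length_statement (tally i) (10 ^ k))"
  let ?e = "config N ?s [] [] w [] [] (tally i) ''a''"
  obtain t j' k' where "bounded_run N N (N + 1) ?e C ?s j 0 t j' k'"
    using bounded_halts[of N N "N + 1" C] assms(2) by fastforce
  then have b: "exec (bounded N (N + 1) C) (config N ?s (tally j) [] w [] [] (tally i) ''a'')
      (config N t (tally j') (tally k') w [] [] (tally i) ''a'')"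
    and t: "k' = 0 \<Longrightarrow> exec C ?s t"
    unfolding bounded_run_def config_merge replicate_0 by simp_all
  show ?thesis
  proof (cases "k' = 0 \<and> t 0 = ''1''")
    case True
    with t have "computes C [length_statement (tally i) (10 ^ k), p] ''1''"
      unfolding computes_pair by blast
    then show ?thesis
      using exec_attempt[OF assms(1) d b] unfolding if_P[OF True] by blast
  next
    case False
    then show ?thesis
      using exec_attempt[OF assms(1) d b] unfolding if_not_P[OF False] by blast
  qed
qed

lemma attempt_success:
  assumes "2 \<le> N" "width C \<le> N" "computes C [length_statement (tally i) (10 ^ k), p] ''1''"
  shows "\<exists>w u. exec (attempt C N k) (search_state N w) u \<and> u (N + 6) = [] \<and> u 0 = tally i"
proof -
  let ?s = "blank(1 := p, 0 := length_statement (tally i) (10 ^ k))"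
  obtain t where t: "exec C ?s t" "t 0 = ''1''"
    using assms(3) unfolding computes_pair by blast
  obtain m where m: "exec (bounded N (N + 1) C) (merge N ?s (e(N := tally (m + j))))
      (merge N t (e(N := tally j)))" for j e
    using exec_bounded[OF t(1) assms(2), of N "N + 1"] by blast
  \<comment> \<open>The fuel part is exactly the amount \<open>m\<close> consumed by the accepting
    run.\<close>
  define w where "w = tally i @ CHR ''b'' # tally m @ CHR ''b'' # rev p"
  have d: "exec (decode N) (search_state N w)
      (config N (blank(1 := p)) (tally m) [] w [] [] (tally i) ''a'')"
    using assms(1) w_def by (rule exec_decode_code)
  have "exec (bounded N (N + 1) C) (config N ?s (tally m) [] w [] [] (tally i) ''a'')
      (config N t (tally 0) (tally 0) w [] [] (tally i) ''a'')"
    using m[of "config N ?s [] [] w [] [] (tally i) ''a''" 0]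
    unfolding config_merge add_0_right replicate_0 .
  from exec_attempt[OF assms(1) d this] t(2) show ?thesis by auto
qed

text \<open>The search may stop before reaching the given triple, hence the possibly different
  \<open>i'\<close> and \<open>p'\<close>; what it outputs is still an accepted candidate.\<close>

lemma search_outputs:
  assumes "2 \<le> N" "width C \<le> N" "computes C [length_statement (tally i) (10 ^ k), p] ''1''"
  shows "\<exists>i' p'. outputs (search C N k) (tally i') \<and>
    computes C [length_statement (tally i') (10 ^ k), p'] ''1''"
proof -
  let ?A = "attempt C N k"
  let ?good = "\<lambda>u. \<exists>i' p'. u 0 = tally i' \<and>
    computes C [length_statement (tally i') (10 ^ k), p'] ''1''"
  obtain w u where wu: "exec ?A (search_state N w) u" "u (N + 6) = []" "u 0 = tally i"
    using attempt_success[OF assms] by blast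
  have ne: "search_state N v (N + 6) \<noteq> []" for v by (simp only: config_apply) simp
  have stop: "exec (While (N + 6) ?A) (search_state N v) u'"
    if "exec ?A (search_state N v) u'" "u' (N + 6) = []" for v u'
    using that ne by (blast intro: exec.WhileStep exec.WhileDone)
  \<comment> \<open>Induction on the distance \<open>n\<close> from \<open>v\<close> to the string
    \<open>w\<close> that is known to succeed.\<close>
  have loop: "\<exists>u. exec (While (N + 6) ?A) (search_state N v) u \<and> ?good u"
    if "(next_string ^^ n) v = w" for n v
    using that
  proof (induction n arbitrary: v)
    case 0
    then have "v = w" by simp
    with wu stop assms(3) show ?case by blast
  next
    case (Suc n)
    then have "(next_string ^^ n) (next_string v) = w" by (simp add: funpow_swap1)
    with Suc.IH obtain u' where u': "exec (While (N + 6) ?A) (search_state N (next_string v)) u'" "?good u'"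
      by blast
    from attempt_cases[OF assms(1,2), of k v] show ?case
    proof
      assume "exec ?A (search_state N v) (search_state N (next_string v))"
      with u' ne show ?case by (blast intro: exec.WhileStep)
    next
      assume "\<exists>u i p. exec ?A (search_state N v) u \<and> u (N + 6) = [] \<and> u 0 = tally i \<and>
        computes C [length_statement (tally i) (10 ^ k), p] ''1''"
      with stop show ?case by blast
    qed
  qed
  obtain n where "(next_string ^^ n) [] = w" using ex_next_string_iterate by blast
  with loop obtain u' where u': "exec (While (N + 6) ?A) (search_state N []) u'" "?good u'"
    by blast
  have "exec (Push (N + 6) (CHR ''a'')) blank (search_state N [])"
    by (rule exec_PushI) (auto simp: config_def merge_def fun_eq_iff)
  with u'(1) have "exec (search C N k) blank u'"
    unfolding search_def by (blast intro: exec.Seq)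
  with u'(2) show ?thesis unfolding outputs_def computes_def by auto
qed


section \<open>Program length\<close>

lemma bit_length_Seq: "bit_length (Seq P Q) = 3 + bit_length P + bit_length Q"
  and bit_length_While: "bit_length (While r P) = 4 + r + bit_length P"
  by (simp_all add: bit_length_def unary_bits_def)

lemma bit_length_pushes: "bit_length (pushes r w) = 3 + (15 + r) * length w"
proof (induction w)
  case Nil
  show ?case by (simp add: bit_length_def)
next
  case (Cons a w)
  have "length (char_bits a) = 8" by (cases a) simp
  then have "bit_length (Push r a) = 12 + r" by (simp add: bit_length_def unary_bits_def)
  with Cons show ?case by (simp add: bit_length_Seq)
qed

text \<open>Only the pushed zeros depend on \<open>k\<close>; each costs 12 bits for
  \<open>Push\<close> on register 0 and 3 for \<open>Seq\<close>.\<close>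

lemma bit_length_search: "bit_length (search C N k) = bit_length (search C N 0) + 15 * k"
  by (simp add: search_def attempt_def build_statement_def bit_length_Seq bit_length_While
      bit_length_pushes del: pushes.simps)

lemma ex_bit_length_search_le: "\<exists>k. bit_length (search C N k) \<le> 10 ^ k"
proof -
  \<comment> \<open>With \<open>k = c + 2\<close> the length is
    \<open>c + 15 * (c + 2) = 16 * c + 30\<close>.\<close>
  have "16 * c + 30 \<le> 10 ^ (c + 2)" for c :: nat
    by (induction c) simp_all
  from this[of "bit_length (search C N 0)"] show ?thesis
    by (intro exI[of _ "bit_length (search C N 0) + 2"]) (subst bit_length_search, simp)
qed

text \<open>Pigeonhole: different outputs need different programs, and the injective code leaves
  finitely many programs of at most \<open>n\<close> bits.\<close>

lemma ex_complex_tally: "\<exists>i. \<forall>P. outputs P (tally i) \<longrightarrow> n < bit_length P"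
proof (rule ccontr)
  assume "\<not> ?thesis"
  then obtain P where P: "\<And>i. outputs (P i) (tally i)" "\<And>i. bit_length (P i) \<le> n"
    by (metis not_le)
  have "inj P"
  proof
    fix i j assume "P i = P j"
    with P(1)[of i] P(1)[of j] have "tally i = tally j"
      unfolding outputs_def using computes_unique by metis
    then show "i = j" by simp
  qed
  moreover have "range P \<subseteq> program_bits -` {bs. set bs \<subseteq> UNIV \<and> length bs \<le> n}"
    using P(2) by (auto simp: bit_length_def)
  moreover have "finite (program_bits -` {bs. set bs \<subseteq> UNIV \<and> length bs \<le> n})"
    by (intro finite_vimageI finite_lists_length_le inj_program_bits) simp
  ultimately show False using range_inj_infinite finite_subset by blast
qed

theorem theorem4:
  fixes Tr :: "string set" and verifiable :: "string \<Rightarrow> string \<Rightarrow> bool" and C :: program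
  assumes "truths_in_Omega Tr"
    and "is_checker Tr verifiable C"
  shows "\<exists>T\<in>Tr. \<forall>p. \<not> computes C [T, p] ''1''"
proof (rule ccontr)
  assume "\<not> ?thesis"
  then have complete: "\<exists>p. computes C [T, p] ''1''" if "T \<in> Tr" for T
    using that by blast
  \<comment> \<open>At least 2, so that the input registers 0 and 1 lie below the auxiliary
    ones.\<close>
  define N where "N = max 2 (width C)"
  have N: "2 \<le> N" "width C \<le> N" by (simp_all add: N_def)
  obtain k where k: "bit_length (search C N k) \<le> 10 ^ k"
    using ex_bit_length_search_le by blast
  have truth: "length_statement x (10 ^ k) \<in> Tr \<longleftrightarrow> (\<forall>P. outputs P x \<longrightarrow> 10 ^ k < bit_length P)" for x
    using assms(1) by (simp add: truths_in_Omega_def Omega_def)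
  obtain i where "length_statement (tally i) (10 ^ k) \<in> Tr"
    using ex_complex_tally truth by blast
  with complete obtain p where "computes C [length_statement (tally i) (10 ^ k), p] ''1''"
    by blast
  from search_outputs[OF N this] obtain i' p' where
    out: "outputs (search C N k) (tally i')"
    and acc: "computes C [length_statement (tally i') (10 ^ k), p'] ''1''" by blast
  \<comment> \<open>An accepted statement is true, yet the search program outputs this candidate
    with at most \<open>10 ^ k\<close> bits.\<close>
  from acc assms(2) have "length_statement (tally i') (10 ^ k) \<in> Tr"
    by (simp add: is_checker_def Omega_def)
  with out k truth show False by (meson not_le)
qed

end
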